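(* Let $X$ be a birth-and-death process on $S=\{0,1,2,\dots\}$ with birth rates $\lambda_i>0$ and death rates $\mu_i>0$ for $i\ge 1$, and with $0$ a trap. Let $f_i$ ($i\ge1$) be the density of the first hitting time $T_0$ of $0$ under $\mathbb{P}_i$, and let $\psi_{\partial_t}(j)$ be the differential polynomial $\psi_{\partial_t}(j)=\sum_{k=1}^{j}C(j,k)\,\partial_t^{k-1}$ ($j\ge1$), with the matrix $C$ defined in the context. Let $\nu$ be a probability measure on $S\setminus\{0\}$. Then $$\mathbb{P}_{\nu}[X_t=j]=\psi_{\partial_t}(j)f_{\nu}(t)\qquad(j\ge 1),$$ where $\mathbb{P}_{\nu}[X_t=j]:=\sum_{i=1}^{\infty}\nu\{i\}\,\mathbb{P}_i[X_t=j]$ and $f_\nu(t):=\sum_{i=1}^{\infty}\nu\{i\}f_i(t)$ ($t>0$).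
   Context: Setting. $X$ is a continuous-time Markov chain on $S=\{0,1,2,\dots\}$ with Q-matrix $Q(i,i-1)=\mu_i$ ($i\ge1$), $Q(i,i+1)=\lambda_i$, $Q(i,i)=-(\lambda_i+\mu_i)$ ($i\ge0$), all other entries $0$, where $\lambda_i,\mu_i>0$ for $i\ge1$ and $\lambda_0=\mu_0=0$ (so $0$ is a trap). Its transition probability $P_t(i,j)=\mathbb{P}_i[X_t=j]$ satisfies the forward and backward equations $\partial_tP_t=P_tQ=QP_t$, i.e. for all $i,j\ge0$, $\partial_tP_t(i,j)=\lambda_{j-1}P_t(i,j-1)-(\lambda_j+\mu_j)P_t(i,j)+\mu_{j+1}P_t(i,j+1)$ (with $\lambda_{-1}P_t(i,-1)$ read as $0$) and $\partial_tP_t(i,j)=\mu_iP_t(i-1,j)-(\lambda_i+\mu_i)P_t(i,j)+\lambda_iP_t(i+1,j)$ (with $\mu_0P_t(-1,j)$ read as $0$). $T_0$ is the first hitting time of $0$; since $0$ is a trap, $\mathbb{P}_i[T_0\le t]=\mathbb{P}_i[X_t=0]$. For $i\ge 1$, $t>0$, $f_i(t):=\partial_t\mathbb{P}_i[T_0\le t]$ is the density of $T_0$ under $\mathbb{P}_i$. Speed measure: $\pi_1=1$, $\pi_i=\dfrac{\lambda_1\cdots\lambda_{i-1}}{\mu_2\cdots\mu_i}$ ($i\ge2$). Scale function: $s(0)=0$, $s(i)=\frac1{\mu_1}+\sum_{j=1}^{i-1}\frac1{\pi_j\lambda_j}$ ($i\ge1$). For $f:S\to\mathbb{R}$, $Qf(i)=\mu_if(i-1)-(\lambda_i+\mu_i)f(i)+\lambda_if(i+1)$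 ($i\ge0$, with $\mu_0f(-1)$ read as $0$). Matrix $C$: $C=(C(i,j))_{i,j\ge0}$, with columns $C_j=(C(i,j))_{i\ge0}$, is the unique matrix with $QC_j=C_{j-1}$ for $j\ge1$, $C_0=0$, $C(i,1)=s(i)$ for $i\ge1$, and $C(i,j)=0$ for $i<j$. Here $\partial_t=\frac{d}{dt}$.
   Formalization: The identity is proved as P_ν[X_t=j] = π_j ψ_{∂_t}(j) f_ν(t), with π the speed measure; the printed formula without the factor π_j fails, e.g. for λ_i=1, μ_i=2 (i≥1), ν=δ_1, j=2. *)

theory Defs
  imports "HOL-Probability.Probability"
begin

text \<open>
  Birth rates \<open>lam\<close> and death rates \<open>mu\<close> on \<open>S = {0, 1, 2, \<dots>}\<close>, with \<open>0\<close> a trap.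
\<close>

definition bd_rates :: "(nat \<Rightarrow> real) \<Rightarrow> (nat \<Rightarrow> real) \<Rightarrow> bool" where
  "bd_rates lam mu \<longleftrightarrow> lam 0 = 0 \<and> mu 0 = 0 \<and> (\<forall>i\<ge>1. 0 < lam i \<and> 0 < mu i)"

definition Q_matrix :: "(nat \<Rightarrow> real) \<Rightarrow> (nat \<Rightarrow> real) \<Rightarrow> nat \<Rightarrow> nat \<Rightarrow> real" where
  "Q_matrix lam mu i j =
     (if i = Suc j then mu i
      else if j = Suc i then lam i
      else if j = i then - (lam i + mu i)
      else 0)"

text \<open>\<open>gen f\<close> is \<open>Q f\<close> (\<open>f\<close> a column); \<open>gen_left p\<close> is \<open>p Q\<close> (\<open>p\<close> a row).\<close>

definition gen :: "(nat \<Rightarrow> real) \<Rightarrow> (nat \<Rightarrow> real) \<Rightarrow> (nat \<Rightarrow> real) \<Rightarrow> nat \<Rightarrow> real" where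
  "gen lam mu f i =
     (if i = 0 then 0 else mu i * f (i - 1)) - (lam i + mu i) * f i + lam i * f (i + 1)"

definition gen_left :: "(nat \<Rightarrow> real) \<Rightarrow> (nat \<Rightarrow> real) \<Rightarrow> (nat \<Rightarrow> real) \<Rightarrow> nat \<Rightarrow> real" where
  "gen_left lam mu p j =
     (if j = 0 then 0 else lam (j - 1) * p (j - 1)) - (lam j + mu j) * p j + mu (j + 1) * p (j + 1)"

definition speed :: "(nat \<Rightarrow> real) \<Rightarrow> (nat \<Rightarrow> real) \<Rightarrow> nat \<Rightarrow> real" where
  "speed lam mu i = (\<Prod>k=1..<i. lam k) / (\<Prod>k=2..i. mu k)"

definition scale :: "(nat \<Rightarrow> real) \<Rightarrow> (nat \<Rightarrow> real) \<Rightarrow> nat \<Rightarrow> real" where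
  "scale lam mu i =
     (if i = 0 then 0 else 1 / mu 1 + (\<Sum>j=1..<i. 1 / (speed lam mu j * lam j)))"


text \<open>
  \<open>M i\<close> is the law \<open>\<bbbP>\<^sub>i\<close>, on a measurable space common to all starting points.  The chain lives
  on \<open>S\<close>; the value \<open>\<infinity> :: enat\<close> is not a state but marks the times at which an explosive path is
  outside \<open>S\<close>, so that \<open>\<Sum>j. P\<^sub>t(i, j)\<close> may be less than \<open>1\<close>.
\<close>

definition trans_prob ::
    "(nat \<Rightarrow> 'w measure) \<Rightarrow> (real \<Rightarrow> 'w \<Rightarrow> enat) \<Rightarrow> real \<Rightarrow> nat \<Rightarrow> nat \<Rightarrow> real" where
  "trans_prob M X t i j = measure (M i) {\<omega> \<in> space (M i). X t \<omega> = enat j}"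

definition history :: "'w set \<Rightarrow> (real \<Rightarrow> 'w \<Rightarrow> enat) \<Rightarrow> real \<Rightarrow> 'w set set" where
  "history \<Omega> X s = sigma_sets \<Omega> {{\<omega> \<in> \<Omega>. X u \<omega> = k} | u k. 0 \<le> u \<and> u \<le> s}"

text \<open>
  Right-continuity refers to the order topology of \<open>enat\<close>, in which every \<open>enat j\<close> is isolated.
  The Markov property is only demanded at times when the path is in \<open>S\<close>.
\<close>

locale birth_death_chain =
  fixes lam mu :: "nat \<Rightarrow> real"
    and M :: "nat \<Rightarrow> 'w measure"
    and X :: "real \<Rightarrow> 'w \<Rightarrow> enat"
  assumes rates: "bd_rates lam mu"
    and prob: "prob_space (M i)"
    and common_sets: "sets (M i) = sets (M 0)"
    and measurable_X: "0 \<le> t \<Longrightarrow> X t \<in> M i \<rightarrow>\<^sub>M count_space UNIV"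
    and right_continuous:
      "\<omega> \<in> space (M 0) \<Longrightarrow> 0 \<le> t \<Longrightarrow> continuous (at_right t) (\<lambda>u. X u \<omega>)"
    and initial: "trans_prob M X 0 i i = 1"
    and Markov:
      "0 \<le> s \<Longrightarrow> 0 \<le> t \<Longrightarrow> A \<in> history (space (M i)) X s \<Longrightarrow>
         measure (M i) (A \<inter> {\<omega> \<in> space (M i). X s \<omega> = enat j \<and> X (s + t) \<omega> = enat k}) =
         measure (M i) (A \<inter> {\<omega> \<in> space (M i). X s \<omega> = enat j}) * trans_prob M X t j k"
    and jump_rates:
      "((\<lambda>t. trans_prob M X t i j) has_real_derivative Q_matrix lam mu i j) (at 0 within {0..})"
    and forward:
      "0 < t \<Longrightarrow>
         ((\<lambda>t. trans_prob M X t i j) has_real_derivative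
            gen_left lam mu (\<lambda>j. trans_prob M X t i j) j) (at t)"
    and backward:
      "0 < t \<Longrightarrow>
         ((\<lambda>t. trans_prob M X t i j) has_real_derivative
            gen lam mu (\<lambda>i. trans_prob M X t i j) i) (at t)"

definition hitting_time_0 :: "(real \<Rightarrow> 'w \<Rightarrow> enat) \<Rightarrow> 'w \<Rightarrow> ereal" where
  "hitting_time_0 X \<omega> = Inf {ereal t | t. 0 \<le> t \<and> X t \<omega> = 0}"

definition hitting_cdf ::
    "(nat \<Rightarrow> 'w measure) \<Rightarrow> (real \<Rightarrow> 'w \<Rightarrow> enat) \<Rightarrow> nat \<Rightarrow> real \<Rightarrow> real" where
  "hitting_cdf M X i t = measure (M i) {\<omega> \<in> space (M i). hitting_time_0 X \<omega> \<le> ereal t}"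

definition hitting_density ::
    "(nat \<Rightarrow> 'w measure) \<Rightarrow> (real \<Rightarrow> 'w \<Rightarrow> enat) \<Rightarrow> nat \<Rightarrow> real \<Rightarrow> real" where
  "hitting_density M X i t = deriv (hitting_cdf M X i) t"


text \<open>
  An initial distribution \<open>\<nu>\<close> on \<open>S - {0}\<close> is a \<open>nat pmf\<close> with \<open>0 \<notin> set_pmf \<nu>\<close>; the sums over
  \<open>i \<ge> 1\<close> are shifted to start at \<open>0\<close>.
\<close>

definition trans_prob_init ::
    "(nat \<Rightarrow> 'w measure) \<Rightarrow> (real \<Rightarrow> 'w \<Rightarrow> enat) \<Rightarrow> nat pmf \<Rightarrow> real \<Rightarrow> nat \<Rightarrow> real" where
  "trans_prob_init M X \<nu> t j = (\<Sum>i. pmf \<nu> (Suc i) * trans_prob M X t (Suc i) j)"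

definition hitting_density_init ::
    "(nat \<Rightarrow> 'w measure) \<Rightarrow> (real \<Rightarrow> 'w \<Rightarrow> enat) \<Rightarrow> nat pmf \<Rightarrow> real \<Rightarrow> real" where
  "hitting_density_init M X \<nu> t = (\<Sum>i. pmf \<nu> (Suc i) * hitting_density M X (Suc i) t)"


definition is_C_matrix ::
    "(nat \<Rightarrow> real) \<Rightarrow> (nat \<Rightarrow> real) \<Rightarrow> (nat \<Rightarrow> nat \<Rightarrow> real) \<Rightarrow> bool" where
  "is_C_matrix lam mu C \<longleftrightarrow>
     (\<forall>j\<ge>1. gen lam mu (\<lambda>i. C i j) = (\<lambda>i. C i (j - 1))) \<and>
     (\<forall>i. C i 0 = 0) \<and>
     (\<forall>i\<ge>1. C i 1 = scale lam mu i) \<and>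
     (\<forall>i j. i < j \<longrightarrow> C i j = 0)"

definition C_matrix :: "(nat \<Rightarrow> real) \<Rightarrow> (nat \<Rightarrow> real) \<Rightarrow> nat \<Rightarrow> nat \<Rightarrow> real" where
  "C_matrix lam mu = (THE C. is_C_matrix lam mu C)"

fun C_rec :: "(nat \<Rightarrow> real) \<Rightarrow> (nat \<Rightarrow> real) \<Rightarrow> nat \<Rightarrow> nat \<Rightarrow> real" where
  "C_rec lam mu 0 j = 0"
| "C_rec lam mu (Suc 0) j = (if j = 1 then 1 / mu 1 else 0)"
| "C_rec lam mu (Suc (Suc i)) j =
     (if j = 0 then 0
      else (C_rec lam mu (Suc i) (j - 1) + (lam (Suc i) + mu (Suc i)) * C_rec lam mu (Suc i) j
            - mu (Suc i) * C_rec lam mu i j) / lam (Suc i))"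

lemma C_rec_0: "C_rec lam mu i 0 = 0"
  by (induction lam mu i "0::nat" rule: C_rec.induct) auto

lemma C_rec_above: "i < j \<Longrightarrow> C_rec lam mu i j = 0"
  by (induction lam mu i j rule: C_rec.induct) auto

lemma speed_Suc:
  assumes "1 \<le> i"
  shows "speed lam mu (Suc i) = speed lam mu i * lam i / mu (Suc i)"
proof -
  have "{1..<Suc i} = insert i {1..<i}" "{2..Suc i} = insert (Suc i) {2..i}"
    using assms by auto
  then show ?thesis
    by (simp add: speed_def mult.commute)
qed

lemma speed_pos: "bd_rates lam mu \<Longrightarrow> 0 < speed lam mu i"
  unfolding speed_def bd_rates_def by (auto intro!: divide_pos_pos prod_pos)

lemma scale_Suc:
  assumes "1 \<le> i"
  shows "scale lam mu (Suc i) = scale lam mu i + 1 / (speed lam mu i * lam i)"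
proof -
  have "{1..<Suc i} = insert i {1..<i}"
    using assms by auto
  then show ?thesis
    using assms by (simp add: scale_def)
qed

lemma gen_scale:
  assumes "bd_rates lam mu"
  shows "lam (Suc i) * (scale lam mu (Suc (Suc i)) - scale lam mu (Suc i)) =
         mu (Suc i) * (scale lam mu (Suc i) - scale lam mu i)"
proof -
  have pos: "0 < lam (Suc k)" "0 < mu (Suc k)" "0 < speed lam mu k" for k
    using assms speed_pos[OF assms] by (auto simp: bd_rates_def)
  have L: "lam (Suc i) * (scale lam mu (Suc (Suc i)) - scale lam mu (Suc i)) =
      1 / speed lam mu (Suc i)"
    using pos(1)[of i] pos(3)[of "Suc i"] by (simp add: scale_Suc)
  show ?thesis
  proof (cases i)
    case 0
    then show ?thesis
      using L pos(2)[of 0] by (simp add: scale_def speed_def)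
  next
    case (Suc k)
    then show ?thesis
      using L pos(1)[of k] pos(2)[of i] pos(3)[of i]
      by (simp add: scale_Suc[of "Suc k"] speed_Suc[of "Suc k"])
  qed
qed

lemma C_rec_1:
  assumes "bd_rates lam mu"
  shows "C_rec lam mu i 1 = scale lam mu i"
proof (induction i rule: less_induct)
  case (less i)
  consider "i = 0" | "i = 1" | k where "i = Suc (Suc k)"
    by (metis One_nat_def not0_implies_Suc)
  then show ?case
  proof cases
    case 3
    have pos: "0 < lam (Suc k)"
      using assms by (auto simp: bd_rates_def)
    have "C_rec lam mu i 1 = ((lam (Suc k) + mu (Suc k)) * scale lam mu (Suc k)
          - mu (Suc k) * scale lam mu k) / lam (Suc k)"
      using less[of k] less[of "Suc k"] 3 by (simp add: C_rec_0)
    also have "\<dots> = scale lam mu i"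
      using gen_scale[OF assms, of k] pos 3 by (simp add: field_simps)
    finally show ?thesis .
  qed (auto simp: scale_def)
qed

lemma is_C_matrix_C_rec:
  assumes "bd_rates lam mu"
  shows "is_C_matrix lam mu (C_rec lam mu)"
proof -
  have "gen lam mu (\<lambda>i. C_rec lam mu i j) i = C_rec lam mu i (j - 1)" if "1 \<le> j" for i j
  proof (cases i)
    case 0
    then show ?thesis
      using assms by (simp add: gen_def bd_rates_def)
  next
    case (Suc k)
    have "0 < lam (Suc k)"
      using assms by (auto simp: bd_rates_def)
    then show ?thesis
      using Suc that by (simp add: gen_def)
  qed
  then show ?thesis
    using C_rec_1[OF assms] C_rec_0 C_rec_above unfolding is_C_matrix_def by blast
qed

lemma is_C_matrix_unique:
  assumes "bd_rates lam mu" and C: "is_C_matrix lam mu C"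
  shows "C = C_rec lam mu"
proof -
  have "C i j = C_rec lam mu i j" for i j
  proof (induction lam\<equiv>lam mu\<equiv>mu i j rule: C_rec.induct)
    case (1 j)
    then show ?case
      using C by (cases j) (auto simp: is_C_matrix_def)
  next
    case (2 j)
    consider "j = 0" | "j = 1" | "1 < j"
      by linarith
    then show ?case
      using C by cases (auto simp: is_C_matrix_def scale_def)
  next
    case (3 i j)
    show ?case
    proof (cases "j = 0")
      case True
      then show ?thesis
        using C by (simp add: is_C_matrix_def)
    next
      case False
      have "0 < lam (Suc i)"
        using assms(1) by (auto simp: bd_rates_def)
      moreover have "gen lam mu (\<lambda>i. C i j) (Suc i) = C (Suc i) (j - 1)"
        using C False unfolding is_C_matrix_def by (metis less_one not_le)
      ultimately show ?thesis
        using False 3 by (simp add: gen_def field_simps)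
    qed
  qed
  then show ?thesis
    by blast
qed

lemma is_C_matrix_C_matrix:
  assumes "bd_rates lam mu"
  shows "\<exists>!C. is_C_matrix lam mu C" "is_C_matrix lam mu (C_matrix lam mu)"
proof -
  show *: "\<exists>!C. is_C_matrix lam mu C"
    using is_C_matrix_C_rec[OF assms] is_C_matrix_unique[OF assms] by blast
  show "is_C_matrix lam mu (C_matrix lam mu)"
    unfolding C_matrix_def by (rule theI'[OF *])
qed


text \<open>
  By detailed balance the forward equation for \<open>P\<^sub>t(i, j)\<close> is the equation \<open>\<partial>\<^sub>t h = Q h\<close> for
  \<open>h(j) = P\<^sub>t(i, j) / speed j\<close> (\<open>j \<ge> 1\<close>), and this is the equation that \<open>j \<mapsto> psi j f\<close> solves.
  Hence \<open>psi\<close> represents the density of \<open>P\<^sub>t(i, \<cdot>)\<close> with respect to the speed measure.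
\<close>

definition psi ::
    "(nat \<Rightarrow> real) \<Rightarrow> (nat \<Rightarrow> real) \<Rightarrow> nat \<Rightarrow> (real \<Rightarrow> real) \<Rightarrow> real \<Rightarrow> real" where
  "psi lam mu j f t = (\<Sum>k=1..j. C_matrix lam mu j k * (deriv ^^ (k - 1)) f t)"

end

theory Submission
  imports Defs
begin

text \<open>
  Since \<open>0\<close> is a trap, \<open>\<bbbP>\<^sub>i[T\<^sub>0 \<le> t] = P\<^sub>t(i, 0)\<close>, so the forward equation at \<open>0\<close> gives
  \<open>f\<^sub>i(t) = \<mu>\<^sub>1 P\<^sub>t(i, 1)\<close>.  For fixed \<open>j\<close> the right-hand side of the forward equation is bounded
  uniformly in \<open>i\<close>, hence the equation survives averaging over \<open>\<nu>\<close> and makes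
  \<open>t \<mapsto> \<bbbP>\<^sub>\<nu>[X\<^sub>t = j]\<close> smooth.  Read as a recursion in \<open>j\<close>, it determines \<open>\<bbbP>\<^sub>\<nu>[X\<^sub>t = j + 1]\<close> from the
  previous two states and a time derivative; after division by the speed measure this is the
  recursion that defines the rows of \<open>C\<close>.
\<close>

section \<open>Derivatives of solutions of the forward equation\<close>

lemma deriv_cong_pos:
  fixes f g :: "real \<Rightarrow> real"
  assumes "\<And>u. 0 < u \<Longrightarrow> f u = g u" "0 < t" "(g has_real_derivative d) (at t)"
  shows "(f has_real_derivative d) (at t)"
  by (rule has_field_derivative_transform_within_open[OF assms(3) open_greaterThan, of 0])
    (simp_all add: assms(1,2))

text \<open>Each row of probabilities gets the same bound, so it majorises the time derivatives for
  all starting states and times at once. At \<open>j = 0\<close> the truncated \<open>j - 1\<close>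
  only enlarges it.\<close>

lemma gen_left_bounded:
  assumes "\<And>k. \<bar>p k\<bar> \<le> 1"
  shows "\<bar>gen_left lam mu p j\<bar> \<le> \<bar>lam (j - 1)\<bar> + \<bar>lam j + mu j\<bar> + \<bar>mu (j + 1)\<bar>"
proof -
  have b: "\<bar>c * p k\<bar> \<le> \<bar>c\<bar>" for c k
    using mult_left_mono[OF assms[of k], of "\<bar>c\<bar>"] by (simp add: abs_mult)
  have "\<bar>x - y + z\<bar> \<le> \<bar>x\<bar> + \<bar>y\<bar> + \<bar>z\<bar>" for x y z :: real
    by linarith
  then show ?thesis
    unfolding gen_left_def by (rule order_trans) (intro add_mono, auto simp: b)
qed

lemma has_derivative_gen_left:
  assumes "\<And>k. ((\<lambda>u. p u k) has_real_derivative q k) (at t)"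
  shows "((\<lambda>u. gen_left lam mu (p u) j) has_real_derivative gen_left lam mu q j) (at t)"
  unfolding gen_left_def
  by (cases "j = 0")
    (simp_all only: if_True if_False simp_thms,
     (intro DERIV_add DERIV_diff DERIV_cmult DERIV_const assms)+)

text \<open>The row \<open>p\<close> times the n-th power of the Q-matrix. Every entry is a finite
  combination of entries of \<open>p\<close>, so no convergence question arises.\<close>

primrec gen_left_pow ::
    "(nat \<Rightarrow> real) \<Rightarrow> (nat \<Rightarrow> real) \<Rightarrow> nat \<Rightarrow> (nat \<Rightarrow> real) \<Rightarrow> nat \<Rightarrow> real" where
  "gen_left_pow lam mu 0 p = p"
| "gen_left_pow lam mu (Suc n) p = gen_left lam mu (gen_left_pow lam mu n p)"

lemma forward_solution_deriv_pow:
  assumes "\<And>t j. 0 < t \<Longrightarrow> ((\<lambda>u. g u j) has_real_derivative gen_left lam mu (g t) j) (at t)"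
    and "0 < t"
  shows "((\<lambda>u. gen_left_pow lam mu n (g u) j) has_real_derivative
           gen_left_pow lam mu (Suc n) (g t) j) (at t)"
proof (induction n arbitrary: j)
  case 0
  then show ?case
    using assms by simp
next
  case (Suc n)
  show ?case
    using has_derivative_gen_left[OF Suc] by simp
qed

text \<open>By induction the n-th derivative of \<open>f\<close> at positive times is
  \<open>c\<close> times entry \<open>j\<close> of \<open>gen_left_pow lam mu n (g u)\<close>, which
  is again differentiable. As \<open>deriv\<close> is total, this is what makes the iterated
  \<open>deriv\<close> genuine derivatives.\<close>

lemma forward_solution_smooth:
  assumes g: "\<And>t j. 0 < t \<Longrightarrow> ((\<lambda>u. g u j) has_real_derivative gen_left lam mu (g t) j) (at t)"
    and f: "\<And>u. 0 < u \<Longrightarrow> f u = c * g u j"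
    and "0 < t"
  shows "((deriv ^^ n) f has_real_derivative (deriv ^^ Suc n) f t) (at t)"
proof -
  have D: "((\<lambda>u. c * gen_left_pow lam mu n (g u) j) has_real_derivative
      c * gen_left_pow lam mu (Suc n) (g u) j) (at u)" if "0 < u" for n u
    using forward_solution_deriv_pow[OF g that] by (intro DERIV_cmult)
  \<comment> \<open>The time stays arbitrary in the induction, since the next derivative depends on
    a whole neighbourhood of \<open>u\<close>.\<close>
  have eq: "(deriv ^^ n) f u = c * gen_left_pow lam mu n (g u) j" if "0 < u" for n u
    using that
  proof (induction n arbitrary: u)
    case (Suc n)
    then show ?case
      using DERIV_imp_deriv[OF deriv_cong_pos[OF _ _ D]] by simp
  qed (simp add: f)
  show ?thesis
    unfolding eq[OF \<open>0 < t\<close>, of "Suc n"]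
    by (rule deriv_cong_pos[OF eq \<open>0 < t\<close> D[OF \<open>0 < t\<close>]])
qed

section \<open>The recursion in the state, for \<open>psi\<close> and for forward solutions\<close>

text \<open>Differentiating in time raises each order by one, which moves column \<open>k\<close> of
  \<open>C\<close> to column \<open>k - 1\<close>. The column relation for \<open>Q\<close> and
  \<open>C\<close> thus becomes the equation \<open>d = Q psi\<close> at state \<open>Suc j\<close>,
  here solved for the next state.\<close>

lemma psi_Suc_Suc:
  assumes rates: "bd_rates lam mu" and "0 < t"
    and f: "\<And>k u. 0 < u \<Longrightarrow> ((deriv ^^ k) f has_real_derivative (deriv ^^ Suc k) f u) (at u)"
    and d: "((\<lambda>u. psi lam mu (Suc j) f u) has_real_derivative d) (at t)"
  shows "lam (Suc j) * psi lam mu (Suc (Suc j)) f t =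
    d + (lam (Suc j) + mu (Suc j)) * psi lam mu (Suc j) f t - mu (Suc j) * psi lam mu j f t"
proof -
  define C where "C = C_rec lam mu"
  have CM: "C_matrix lam mu = C"
    unfolding C_def using is_C_matrix_unique[OF rates is_C_matrix_C_matrix(2)[OF rates]] .
  \<comment> \<open>The sums for three consecutive states are padded to one range with entries of
    \<open>C\<close> above the diagonal, which vanish, so that they can be compared term by
    term.\<close>
  have psi: "psi lam mu i f u = (\<Sum>k<Suc (Suc j). C i (Suc k) * (deriv ^^ k) f u)"
    if "i \<le> Suc (Suc j)" for i u
  proof -
    have "psi lam mu i f u = (\<Sum>k<i. C i (Suc k) * (deriv ^^ k) f u)"
      unfolding psi_def CM by (rule sum.reindex_bij_witness[of _ Suc "\<lambda>k. k - 1"]) auto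
    also have "\<dots> = (\<Sum>k<Suc (Suc j). C i (Suc k) * (deriv ^^ k) f u)"
      using that by (intro sum.mono_neutral_left) (auto simp: C_def C_rec_above)
    finally show ?thesis .
  qed
  have "((\<lambda>u. \<Sum>k<Suc (Suc j). C (Suc j) (Suc k) * (deriv ^^ k) f u) has_real_derivative
      (\<Sum>k<Suc (Suc j). C (Suc j) (Suc k) * (deriv ^^ Suc k) f t)) (at t)"
    by (intro DERIV_sum DERIV_cmult f \<open>0 < t\<close>)
  then have "d = (\<Sum>k<Suc (Suc j). C (Suc j) (Suc k) * (deriv ^^ Suc k) f t)"
    using d psi by (simp add: DERIV_unique)
  \<comment> \<open>Shifting the index gains the term \<open>k = 0\<close> and loses the term
    \<open>k = Suc (Suc j)\<close>. Both are zero: column 0 vanishes, and the other entry lies above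
    the diagonal.\<close>
  also have "\<dots> = (\<Sum>k<Suc (Suc j). C (Suc j) k * (deriv ^^ k) f t)"
    using C_rec_0[of lam mu "Suc j"] C_rec_above[of "Suc j" "Suc (Suc j)" lam mu]
      sum.lessThan_Suc_shift[of "\<lambda>k. C (Suc j) k * (deriv ^^ k) f t" "Suc (Suc j)"]
      sum.lessThan_Suc[of "\<lambda>k. C (Suc j) k * (deriv ^^ k) f t" "Suc (Suc j)"]
    by (simp only: C_def mult_zero_left add_0_left add_0_right lessI simp_thms)
  finally have d_eq: "d = (\<Sum>k<Suc (Suc j). C (Suc j) k * (deriv ^^ k) f t)" .
  have "lam (Suc j) * C (Suc (Suc j)) (Suc k) =
      C (Suc j) k + (lam (Suc j) + mu (Suc j)) * C (Suc j) (Suc k) - mu (Suc j) * C j (Suc k)" for k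
    using rates by (auto simp: C_def bd_rates_def less_imp_neq[THEN not_sym])
  then have "lam (Suc j) * (C (Suc (Suc j)) (Suc k) * x) =
      C (Suc j) k * x + (lam (Suc j) + mu (Suc j)) * (C (Suc j) (Suc k) * x)
      - mu (Suc j) * (C j (Suc k) * x)" for k x
    by (metis (no_types) left_diff_distrib distrib_right mult.assoc)
  then show ?thesis
    by (simp add: psi d_eq sum_distrib_left sum.distrib sum_subtractf del: sum.lessThan_Suc)
qed

text \<open>Detailed balance, \<open>speed j * lam j = speed (j + 1) * mu (j + 1)\<close> for
  \<open>j \<ge> 1\<close>, turns the row action of \<open>Q\<close> into its column action. At
  state 1 the inflow from 0 drops out because \<open>lam 0 = 0\<close>, so \<open>h 0\<close> does
  not appear.\<close>

lemma gen_left_speed: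
  assumes "bd_rates lam mu"
  shows "gen_left lam mu (\<lambda>j. speed lam mu j * h j) (Suc j) = speed lam mu (Suc j) *
    (lam (Suc j) * h (Suc (Suc j)) - (lam (Suc j) + mu (Suc j)) * h (Suc j)
      + (if j = 0 then 0 else mu (Suc j) * h j))"
proof -
  have mu: "mu (Suc i) \<noteq> 0" and lam0: "lam 0 = 0" for i
    using assms by (auto simp: bd_rates_def less_imp_neq[THEN not_sym])
  have up: "mu (Suc (Suc j)) * speed lam mu (Suc (Suc j)) = speed lam mu (Suc j) * lam (Suc j)"
    using mu by (simp add: speed_Suc[of "Suc j"])
  have down: "lam j * speed lam mu j = (if j = 0 then 0 else speed lam mu (Suc j) * mu (Suc j))"
    using mu lam0 by (simp add: speed_Suc)
  have "gen_left lam mu (\<lambda>j. speed lam mu j * h j) (Suc j) =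
      lam j * speed lam mu j * h j - (lam (Suc j) + mu (Suc j)) * (speed lam mu (Suc j) * h (Suc j))
      + mu (Suc (Suc j)) * speed lam mu (Suc (Suc j)) * h (Suc (Suc j))"
    by (simp add: gen_left_def)
  then show ?thesis
    unfolding up down by (simp add: algebra_simps)
qed

text \<open>After division by \<open>speed\<close>, both sides obey the same recursion over two
  preceding states, hence the strong induction. At state 1, \<open>psi\<close> is
  \<open>f / mu 1\<close> and \<open>speed\<close> is 1.\<close>

lemma forward_solution_eq_psi:
  assumes rates: "bd_rates lam mu"
    and g: "\<And>t j. 0 < t \<Longrightarrow> ((\<lambda>u. g u j) has_real_derivative gen_left lam mu (g t) j) (at t)"
    and f: "\<And>u. 0 < u \<Longrightarrow> f u = mu 1 * g u 1"
    and "0 < t"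
  shows "g t (Suc j) = speed lam mu (Suc j) * psi lam mu (Suc j) f t"
  using \<open>0 < t\<close>
proof (induction j arbitrary: t rule: less_induct)
  case (less j)
  have pos: "0 < lam (Suc i)" "0 < mu (Suc i)" "0 < speed lam mu i" for i
    using rates speed_pos[OF rates] by (auto simp: bd_rates_def)
  show ?case
  proof (cases j)
    case 0
    have "C_matrix lam mu 1 1 = 1 / mu 1"
      using is_C_matrix_C_matrix(2)[OF rates] by (simp add: is_C_matrix_def scale_def)
    then show ?thesis
      using f[OF less.prems] pos(2)[of 0] 0 by (simp add: psi_def speed_def)
  next
    case (Suc i)
    define h where "h = (\<lambda>u k. g u k / speed lam mu k)"
    have g_h: "g u = (\<lambda>k. speed lam mu k * h u k)" for u
      using pos(3) by (auto simp: h_def less_imp_neq[THEN not_sym])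
    have IH: "h u (Suc k) = psi lam mu (Suc k) f u" if "k < j" "0 < u" for k u
      using less.IH[OF that] pos(3)[of "Suc k"] by (simp add: h_def)
    have "((\<lambda>u. h u (Suc i)) has_real_derivative
        gen_left lam mu (g t) (Suc i) / speed lam mu (Suc i)) (at t)"
      unfolding h_def by (intro DERIV_cdivide g less.prems)
    \<comment> \<open>The induction hypothesis holds at all positive times, so the derivative
      supplied by the forward equation is also that of \<open>psi\<close>.\<close>
    then have "((\<lambda>u. psi lam mu (Suc i) f u) has_real_derivative
        gen_left lam mu (g t) (Suc i) / speed lam mu (Suc i)) (at t)"
      using deriv_cong_pos[OF _ less.prems] IH Suc by (metis lessI)
    note psi_Suc_Suc[OF rates less.prems forward_solution_smooth[OF g f] this]
    moreover have "gen_left lam mu (g t) (Suc i) / speed lam mu (Suc i) =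
        lam (Suc i) * h t (Suc (Suc i)) - (lam (Suc i) + mu (Suc i)) * h t (Suc i)
        + (if i = 0 then 0 else mu (Suc i) * h t i)"
      unfolding g_h[of t] gen_left_speed[OF rates] using pos(3)[of "Suc i"] by simp
    \<comment> \<open>For \<open>i = 0\<close> the missing inflow matches \<open>psi\<close> at
      state 0, which is an empty sum.\<close>
    moreover have "(if i = 0 then 0 else mu (Suc i) * h t i) = mu (Suc i) * psi lam mu i f t"
      using IH[of "i - 1"] less.prems Suc by (cases i) (simp_all add: psi_def del: sum.cl_ivl_Suc)
    ultimately have "lam (Suc i) * psi lam mu (Suc (Suc i)) f t = lam (Suc i) * h t (Suc (Suc i))"
      using IH[of i] less.prems Suc by simp
    then show ?thesis
      using pos(1)[of i] Suc g_h[of t] by simp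
  qed
qed

section \<open>Averages of bounded sequences over an initial distribution\<close>

lemma summable_pmf_bounded:
  fixes \<nu> :: "nat pmf" and a :: "nat \<Rightarrow> real"
  assumes "\<And>i. \<bar>a i\<bar> \<le> K"
  shows "summable (\<lambda>i. pmf \<nu> (Suc i) * a i)"
proof (rule summable_comparison_test)
  have "summable (pmf \<nu>)"
    using summable_on_imp_summable[of "pmf \<nu>"] pmf_abs_summable[of \<nu> UNIV]
    by (simp add: abs_summable_on_nat_iff)
  then show "summable (\<lambda>i. pmf \<nu> (Suc i) * K)"
    by (intro summable_mult2) (simp add: summable_Suc_iff)
  show "\<exists>N. \<forall>i\<ge>N. norm (pmf \<nu> (Suc i) * a i) \<le> pmf \<nu> (Suc i) * K"
    using assms by (auto simp: abs_mult intro!: mult_left_mono)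
qed

section \<open>Absorption at 0 and the law of the hitting time\<close>

context birth_death_chain
begin

lemma trans_prob_bounded: "\<bar>trans_prob M X t i j\<bar> \<le> 1"
  using prob_space.prob_le_1[OF prob] by (simp add: trans_prob_def)

lemma space_M: "space (M i) = space (M 0)"
  using common_sets by (rule sets_eq_imp_space_eq)

lemma sets_X_eq: "0 \<le> t \<Longrightarrow> {\<omega> \<in> space (M i). X t \<omega> = k} \<in> sets (M i)"
  using measurable_sets[OF measurable_X, of t "{k}" i]
  by (simp add: vimage_def Int_def conj_commute)

text \<open>Row 0 of \<open>Q\<close> is zero, so the backward equation makes this probability
  constant on positive times. \<open>jump_rates\<close> covers the derivative at time 0 and
  \<open>initial\<close> fixes the constant.\<close>

lemma trans_prob_trap:
  assumes "0 \<le> t"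
  shows "trans_prob M X t 0 0 = 1"
proof -
  have zero: "lam 0 = 0" "mu 0 = 0"
    using rates by (auto simp: bd_rates_def)
  have "((\<lambda>t. trans_prob M X t 0 0) has_real_derivative 0) (at u within {0..})" if "0 \<le> u" for u
  proof (cases "u = 0")
    case True
    then show ?thesis
      using jump_rates[of 0 0] zero by (simp add: Q_matrix_def)
  next
    case False
    then show ?thesis
      using backward[of u 0 0] that zero by (auto simp: gen_def intro: has_field_derivative_at_within)
  qed
  then obtain c where "\<And>u. 0 \<le> u \<Longrightarrow> trans_prob M X u 0 0 = c"
    using has_field_derivative_zero_constant[of "{0..}" "\<lambda>t. trans_prob M X t 0 0"] by auto
  then show ?thesis
    using initial[of 0] assms by (metis order_refl)
qed

text \<open>The Markov property at time \<open>s\<close>, with the whole space as history event,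
  gives \<open>X s = 0 \<and> X t = 0\<close> the same probability as
  \<open>X s = 0\<close>.\<close>

lemma AE_trap:
  assumes "0 \<le> s" "s \<le> t"
  shows "AE \<omega> in M i. X s \<omega> = 0 \<longrightarrow> X t \<omega> = 0"
proof -
  interpret prob_space "M i"
    by (rule prob)
  let ?S = "{\<omega> \<in> space (M i). X s \<omega> = 0}" and ?T = "{\<omega> \<in> space (M i). X t \<omega> = 0}"
  have sets: "?S \<in> sets (M i)" "?T \<in> sets (M i)"
    using assms by (auto intro: sets_X_eq)
  have "space (M i) \<in> history (space (M i)) X s"
    unfolding history_def by (rule sigma_sets_top)
  from Markov[OF assms(1) _ this, of "t - s" 0 0] assms
  have "measure (M i) (?S \<inter> ?T) = measure (M i) ?S"
    by (simp add: trans_prob_trap zero_enat_def[symmetric] Int_def conj_ac cong: conj_cong)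
  then have "measure (M i) (?S - ?T) = 0"
    using finite_measure_Diff'[OF sets] by simp
  then show ?thesis
    using sets by (intro AE_I[of _ _ "?S - ?T"]) (auto simp: emeasure_eq_measure)
qed

text \<open>By right-continuity a visit to 0 lasts for some time and so contains a rational time; a
  visit at \<open>t\<close> itself is covered by inserting \<open>t\<close>. Countably many times
  then suffice for measurability and almost sure statements.\<close>

lemma hitting_time_0_le_iff:
  assumes \<omega>: "\<omega> \<in> space (M 0)" and "0 \<le> t"
  shows "hitting_time_0 X \<omega> \<le> ereal t \<longleftrightarrow> (\<exists>s\<in>insert t (\<rat> \<inter> {0..t}). X s \<omega> = 0)"
proof
  assume le: "hitting_time_0 X \<omega> \<le> ereal t"
  \<comment> \<open>If 0 is avoided up to \<open>t\<close>, right-continuity at \<open>t\<close>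
    extends this to some \<open>b > t\<close>, which bounds the infimum from below.\<close>
  have "\<exists>u\<in>{0..t}. X u \<omega> = 0"
  proof (rule ccontr)
    assume no: "\<not> ?thesis"
    then have "0 < X t \<omega>"
      using \<open>0 \<le> t\<close> by auto
    then have "eventually (\<lambda>u. 0 < X u \<omega>) (at_right t)"
      using right_continuous[OF assms] unfolding continuous_within by (rule order_tendstoD(1)[rotated])
    then obtain b where b: "t < b" "\<And>u. t < u \<Longrightarrow> u < b \<Longrightarrow> 0 < X u \<omega>"
      unfolding eventually_at_right_field by blast
    have "b \<le> u" if "0 \<le> u" "X u \<omega> = 0" for u
      using no b(2)[of u] that by fastforce
    then have "ereal b \<le> hitting_time_0 X \<omega>"
      unfolding hitting_time_0_def by (auto intro!: Inf_greatest)
    with le have "ereal b \<le> ereal t"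
      by (rule order_trans[rotated])
    then show False
      using b(1) by simp
  qed
  then obtain u where u: "0 \<le> u" "u \<le> t" "X u \<omega> = 0"
    by auto
  show "\<exists>s\<in>insert t (\<rat> \<inter> {0..t}). X s \<omega> = 0"
  proof (cases "u = t")
    case False
    have "(0::enat) < 1"
      by simp
    \<comment> \<open>In \<open>enat\<close>, being below 1 means being 0.\<close>
    then have "eventually (\<lambda>v. X v \<omega> < 1) (at_right u)"
      using right_continuous[OF \<omega> u(1)] u(3) unfolding continuous_within
      by (metis order_tendstoD(2))
    then obtain b where b: "u < b" "\<And>v. u < v \<Longrightarrow> v < b \<Longrightarrow> X v \<omega> < 1"
      unfolding eventually_at_right_field by blast
    obtain r where "r \<in> \<rat>" "u < r" "r < min b t"
      using Rats_dense_in_real[of u "min b t"] b(1) u(2) False by auto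
    then show ?thesis
      using b(2)[of r] u(1) by (intro bexI[of _ r]) (auto simp: one_eSuc)
  qed (use u in auto)
next
  assume "\<exists>s\<in>insert t (\<rat> \<inter> {0..t}). X s \<omega> = 0"
  then obtain s where "0 \<le> s" "s \<le> t" "X s \<omega> = 0"
    using \<open>0 \<le> t\<close> by auto
  then have "hitting_time_0 X \<omega> \<le> ereal s" "ereal s \<le> ereal t"
    unfolding hitting_time_0_def by (auto intro: Inf_lower)
  then show "hitting_time_0 X \<omega> \<le> ereal t"
    by (rule order_trans)
qed

text \<open>The event \<open>T\<^sub>0 \<le> t\<close> is a countable union of events
  \<open>X s = 0\<close> with \<open>s \<le> t\<close>. Each is almost surely contained in
  \<open>X t = 0\<close>, which is itself one of them.\<close>

lemma hitting_cdf_eq_trans_prob: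
  assumes "0 \<le> t"
  shows "hitting_cdf M X i t = trans_prob M X t i 0"
proof -
  interpret prob_space "M i"
    by (rule prob)
  define R where "R = insert t (\<rat> \<inter> {0..t})"
  have R: "countable R" "\<And>s. s \<in> R \<Longrightarrow> 0 \<le> s \<and> s \<le> t"
    using assms by (auto simp: R_def countable_rat)
  have eq: "{\<omega> \<in> space (M i). hitting_time_0 X \<omega> \<le> ereal t} =
      (\<Union>s\<in>R. {\<omega> \<in> space (M i). X s \<omega> = 0})"
    using hitting_time_0_le_iff[OF _ assms] space_M[of i] by (auto simp: R_def)
  have meas: "(\<Union>s\<in>R. {\<omega> \<in> space (M i). X s \<omega> = 0}) \<in> sets (M i)"
    using R by (intro sets.countable_UN'' sets_X_eq) auto
  have "AE \<omega> in M i. \<forall>s\<in>R. X s \<omega> = 0 \<longrightarrow> X t \<omega> = 0"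
    using R AE_trap by (subst AE_ball_countable) auto
  then have "measure (M i) (\<Union>s\<in>R. {\<omega> \<in> space (M i). X s \<omega> = 0}) =
      measure (M i) {\<omega> \<in> space (M i). X t \<omega> = 0}"
    by (intro finite_measure_eq_AE meas sets_X_eq assms) (auto simp: R_def)
  then show ?thesis
    by (simp add: hitting_cdf_def trans_prob_def eq zero_enat_def)
qed

lemma hitting_cdf_has_derivative:
  assumes "0 < t"
  shows "(hitting_cdf M X i has_real_derivative mu 1 * trans_prob M X t i 1) (at t)"
proof -
  have "lam 0 = 0" "mu 0 = 0"
    using rates by (auto simp: bd_rates_def)
  then have "gen_left lam mu (\<lambda>j. trans_prob M X t i j) 0 = mu 1 * trans_prob M X t i 1"
    by (simp add: gen_left_def)
  then show ?thesis
    using forward[OF assms, of i 0] assms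
    by (intro deriv_cong_pos[OF hitting_cdf_eq_trans_prob]) auto
qed

lemma hitting_density_eq: "0 < t \<Longrightarrow> hitting_density M X i t = mu 1 * trans_prob M X t i 1"
  unfolding hitting_density_def by (intro DERIV_imp_deriv hitting_cdf_has_derivative)

section \<open>The forward equation under an initial distribution\<close>

lemma summable_trans_prob_init: "summable (\<lambda>i. pmf \<nu> (Suc i) * trans_prob M X t (Suc i) j)"
  using trans_prob_bounded by (rule summable_pmf_bounded)

text \<open>The series may be differentiated termwise: its derivatives are dominated by
  \<open>pmf \<nu> (Suc i) * K\<close>, uniformly in time. The operator \<open>gen_left\<close>
  reads at most three entries and so commutes with the sum.\<close>

lemma trans_prob_init_forward:
  assumes "0 < t"
  shows "((\<lambda>t. trans_prob_init M X \<nu> t j) has_real_derivative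
    gen_left lam mu (trans_prob_init M X \<nu> t) j) (at t)"
proof -
  define K where "K = \<bar>lam (j - 1)\<bar> + \<bar>lam j + mu j\<bar> + \<bar>mu (j + 1)\<bar>"
  define G where "G i u = pmf \<nu> (Suc i) * gen_left lam mu (trans_prob M X u (Suc i)) j" for i u
  have "summable (\<lambda>i. pmf \<nu> (Suc i) * K)"
    by (rule summable_pmf_bounded[of _ "\<bar>K\<bar>"]) simp
  moreover have "norm (G i u) \<le> pmf \<nu> (Suc i) * K" for i u
    using gen_left_bounded[of "trans_prob M X u (Suc i)" lam mu j] trans_prob_bounded
    by (auto simp: G_def K_def abs_mult intro!: mult_left_mono)
  ultimately have unif: "uniformly_convergent_on {0<..} (\<lambda>n u. \<Sum>i<n. G i u)"
    by (intro Weierstrass_m_test')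
  have "((\<lambda>t. \<Sum>i. pmf \<nu> (Suc i) * trans_prob M X t (Suc i) j) has_real_derivative
      (\<Sum>i. G i t)) (at t)"
  proof (rule has_field_derivative_series'(2)[OF _ _ unif])
    show "((\<lambda>u. pmf \<nu> (Suc i) * trans_prob M X u (Suc i) j) has_real_derivative G i u)
        (at u within {0<..})" if "u \<in> {0<..}" for i u
      unfolding G_def using forward[of u "Suc i" j] that
      by (intro DERIV_cmult) (auto intro: has_field_derivative_at_within)
  qed (use assms summable_trans_prob_init[of \<nu> t j] in \<open>auto simp: interior_open\<close>)
  moreover have "(\<Sum>i. G i t) = gen_left lam mu (trans_prob_init M X \<nu> t) j"
  proof (rule sums_unique[symmetric])
    note S = summable_sums[OF summable_trans_prob_init, of \<nu> t, folded trans_prob_init_def]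
    have "(\<lambda>i.
          (if j = 0 then 0 else lam (j - 1) * (pmf \<nu> (Suc i) * trans_prob M X t (Suc i) (j - 1)))
          - (lam j + mu j) * (pmf \<nu> (Suc i) * trans_prob M X t (Suc i) j)
          + mu (j + 1) * (pmf \<nu> (Suc i) * trans_prob M X t (Suc i) (j + 1)))
        sums gen_left lam mu (trans_prob_init M X \<nu> t) j"
      unfolding gen_left_def
      by (cases "j = 0")
        (simp_all only: if_True if_False simp_thms,
         (intro sums_add sums_diff sums_mult S sums_zero)+)
    then show "(\<lambda>i. G i t) sums gen_left lam mu (trans_prob_init M X \<nu> t) j"
      by (rule back_subst[where P = "\<lambda>a. a sums _"]) (auto simp: G_def gen_left_def algebra_simps)
  qed
  ultimately show ?thesis
    by (simp add: trans_prob_init_def)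
qed

lemma hitting_density_init_eq:
  assumes "0 < t"
  shows "hitting_density_init M X \<nu> t = mu 1 * trans_prob_init M X \<nu> t 1"
  unfolding hitting_density_init_def trans_prob_init_def hitting_density_eq[OF assms]
  by (subst suminf_mult[OF summable_trans_prob_init, symmetric]) (simp add: mult.left_commute)

end

theorem theorem1p1:
  fixes lam mu :: "nat \<Rightarrow> real"
    and M :: "nat \<Rightarrow> 'w measure"
    and X :: "real \<Rightarrow> 'w \<Rightarrow> enat"
    and \<nu> :: "nat pmf"
    and t :: real
    and j :: nat
  assumes "birth_death_chain lam mu M X"
    and "0 \<notin> set_pmf \<nu>"
    and "0 < t"
    and "1 \<le> j"
  shows "(\<forall>i\<ge>1. hitting_cdf M X i differentiable (at t)) \<and>
         summable (\<lambda>i. pmf \<nu> (Suc i) * trans_prob M X t (Suc i) j) \<and>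
         summable (\<lambda>i. pmf \<nu> (Suc i) * hitting_density M X (Suc i) t) \<and>
         (\<forall>k. (deriv ^^ k) (hitting_density_init M X \<nu>) differentiable (at t)) \<and>
         trans_prob_init M X \<nu> t j =
           speed lam mu j * psi lam mu j (hitting_density_init M X \<nu>) t"
proof -
  interpret birth_death_chain lam mu M X
    by fact
  have "summable (\<lambda>i. pmf \<nu> (Suc i) * hitting_density M X (Suc i) t)"
    using summable_mult[OF summable_trans_prob_init, of "mu 1" \<nu> t 1] \<open>0 < t\<close>
    by (simp add: hitting_density_eq mult.left_commute)
  moreover have "hitting_cdf M X i differentiable (at t)" for i
    using hitting_cdf_has_derivative[OF \<open>0 < t\<close>] by (auto simp: real_differentiable_def)
  moreover have "(deriv ^^ k) (hitting_density_init M X \<nu>) differentiable (at t)" for k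
    using forward_solution_smooth[OF trans_prob_init_forward hitting_density_init_eq \<open>0 < t\<close>]
    by (auto simp: real_differentiable_def)
  \<comment> \<open>The averaged probabilities are the forward solution. States from 1 on are
    written as successors there, hence the instance \<open>j - 1\<close>.\<close>
  moreover have "trans_prob_init M X \<nu> t j =
      speed lam mu j * psi lam mu j (hitting_density_init M X \<nu>) t"
    using forward_solution_eq_psi[OF rates trans_prob_init_forward hitting_density_init_eq \<open>0 < t\<close>,
        of \<nu> "j - 1"] \<open>1 \<le> j\<close> by simp
  ultimately show ?thesis
    using summable_trans_prob_init by blast
qed

end
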